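(* For all integers $m,n\ge 4$, $\gamma_{oiR}(P_{n}\Box C_{m})\le \frac{5mn+5n+2m}{8}$.
   Context: All graphs are simple and undirected. $P_n$ denotes the path on $n$ vertices and $C_m$ the cycle on $m$ vertices; $P_n\Box C_m$ is their Cartesian product, with vertex set $\{v_{i,j}: 0\le i\le n-1,\ 0\le j\le m-1\}$, where $v_{i,j}$ and $v_{i',j'}$ are adjacent iff either $i=i'$ and $j'\equiv j\pm1 \pmod m$, or $j=j'$ and $|i-i'|=1$. For a graph $G=(V,E)$, an outer independent Roman dominating function (OIRDF) is a function $f:V\to\{0,1,2\}$ such that every vertex $u$ with $f(u)=0$ has a neighbour $v$ with $f(v)=2$, and the set $V_0=\{u\in V: f(u)=0\}$ is an independent set. The weight of $f$ is $w(f)=\sum_{v\in V}f(v)$, and $\gamma_{oiR}(G)$ is the minimum weight of an OIRDF of $G$. *)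

theory Defs
  imports Complex_Main "HOL-Number_Theory.Cong" "Graph_Theory.Pair_Digraph"
begin

text \<open>Simple undirected graphs are \<^locale>\<open>pair_graph\<close>s: an edge between two vertices is the
  pair of opposite arcs.\<close>

definition path_graph :: "nat \<Rightarrow> nat pair_pre_digraph" where
  "path_graph n = \<lparr> pverts = {0..<n},
     parcs = {(i, i'). i < n \<and> i' < n \<and> \<bar>int i - int i'\<bar> = 1} \<rparr>"

text \<open>The intended graph for \<open>m \<ge> 3\<close> only; for \<open>m = 1\<close> the single vertex carries a loop.\<close>

definition cycle_graph :: "nat \<Rightarrow> nat pair_pre_digraph" where
  "cycle_graph m = \<lparr> pverts = {0..<m},
     parcs = {(j, j'). j < m \<and> j' < m \<and>
       ([int j' = int j + 1] (mod int m) \<or> [int j' = int j - 1] (mod int m))} \<rparr>"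

definition cartesian_product ::
    "'a pair_pre_digraph \<Rightarrow> 'b pair_pre_digraph \<Rightarrow> ('a \<times> 'b) pair_pre_digraph"
    (infixr "\<box>" 80) where
  "G \<box> H = \<lparr> pverts = pverts G \<times> pverts H,
     parcs = {((u, v), (u', v')).
       (u = u' \<and> u \<in> pverts G \<and> (v, v') \<in> parcs H) \<or>
       (v = v' \<and> v \<in> pverts H \<and> (u, u') \<in> parcs G)} \<rparr>"

definition independent_set :: "'a pair_pre_digraph \<Rightarrow> 'a set \<Rightarrow> bool" where
  "independent_set G S \<longleftrightarrow>
     S \<subseteq> pverts G \<and> (\<forall>u\<in>S. \<forall>v\<in>S. (u, v) \<notin> parcs G)"

text \<open>Only the values of \<open>f\<close> on the vertices matter.\<close>

definition OIRDF :: "'a pair_pre_digraph \<Rightarrow> ('a \<Rightarrow> nat) \<Rightarrow> bool" where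
  "OIRDF G f \<longleftrightarrow>
     f ` pverts G \<subseteq> {0, 1, 2} \<and>
     (\<forall>u\<in>pverts G. f u = 0 \<longrightarrow> (\<exists>v\<in>pverts G. (u, v) \<in> parcs G \<and> f v = 2)) \<and>
     independent_set G {u \<in> pverts G. f u = 0}"

definition weight :: "'a pair_pre_digraph \<Rightarrow> ('a \<Rightarrow> nat) \<Rightarrow> nat" where
  "weight G f = (\<Sum>v\<in>pverts G. f v)"

definition gamma_oiR :: "'a pair_pre_digraph \<Rightarrow> nat" where
  "gamma_oiR G = (LEAST w. \<exists>f. OIRDF G f \<and> w = weight G f)"

lemma gamma_oiR_attained: "\<exists>f. OIRDF G f \<and> gamma_oiR G = weight G f"
proof -
  have "OIRDF G (\<lambda>_. 2)"
    by (auto simp: OIRDF_def independent_set_def)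
  then have "\<exists>w. \<exists>f. OIRDF G f \<and> w = weight G f" by blast
  then show ?thesis unfolding gamma_oiR_def by (rule LeastI_ex)
qed

lemma gamma_oiR_le: "OIRDF G f \<Longrightarrow> gamma_oiR G \<le> weight G f"
  unfolding gamma_oiR_def by (rule Least_le) blast

lemma pair_graph_path_graph: "pair_graph (path_graph n)"
proof -
  have "finite (parcs (path_graph n))"
    by (rule finite_subset[of _ "{0..<n} \<times> {0..<n}"]) (auto simp: path_graph_def)
  then show ?thesis
    by unfold_locales (auto simp: path_graph_def symmetric_def sym_def)
qed

lemma pair_graph_cycle_graph:
  assumes "m \<ge> 3"
  shows "pair_graph (cycle_graph m)"
proof -
  have "finite (parcs (cycle_graph m))"
    by (rule finite_subset[of _ "{0..<m} \<times> {0..<m}"]) (auto simp: cycle_graph_def)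
  then show ?thesis using assms
    by unfold_locales
      (auto simp: cycle_graph_def symmetric_def sym_def cong_iff_dvd_diff algebra_simps
         zdvd_not_zless dvd_diff_commute dest: zdvd_imp_le)
qed

lemma pair_graph_cartesian_product:
  assumes "pair_graph G" "pair_graph H"
  shows "pair_graph (G \<box> H)"
proof -
  interpret G: pair_graph G by fact
  interpret H: pair_graph H by fact
  have arcs: "parcs (G \<box> H) \<subseteq> pverts (G \<box> H) \<times> pverts (G \<box> H)"
    by (auto simp: cartesian_product_def dest: G.in_arcsD1 G.in_arcsD2 H.in_arcsD1 H.in_arcsD2)
  have verts: "finite (pverts (G \<box> H))"
    by (simp add: cartesian_product_def)
  have fin: "finite (parcs (G \<box> H))"
    by (rule finite_subset[OF arcs]) (simp add: verts)
  have sym: "symmetric (with_proj (G \<box> H))"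
    using G.arcs_symmetric H.arcs_symmetric
    by (auto simp: cartesian_product_def symmetric_def sym_def)
  have loops: "fst e \<noteq> snd e" if "e \<in> parcs (G \<box> H)" for e
    using that G.pair_no_loops H.pair_no_loops by (fastforce simp: cartesian_product_def)
  show ?thesis
    by unfold_locales (use arcs fin sym loops verts in auto)
qed

lemma cartesian_path_cycle_adjacent:
  assumes "i < n" "i' < n" "j < m" "j' < m"
  shows "((i, j), (i', j')) \<in> parcs (path_graph n \<box> cycle_graph m) \<longleftrightarrow>
    (i = i' \<and> ([int j' = int j + 1] (mod int m) \<or> [int j' = int j - 1] (mod int m))) \<or>
    (j = j' \<and> \<bar>int i - int i'\<bar> = 1)"
  using assms by (auto simp: cartesian_product_def path_graph_def cycle_graph_def)

end

theory Submission
  imports Defs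
begin

text \<open>The zeros form a checkerboard, and the twos are spread over the opposite colour class so that
  every inner zero has exactly one neighbour of value two: rows of the forms
  \<open>1020 1020 \<dots>\<close> and \<open>2010 2010 \<dots>\<close> alternate, separated by rows \<open>0101 0101 \<dots>\<close>.
  This has density \<open>5/8\<close>. If \<open>n\<close> is even, the last row is \<open>0101 \<dots>\<close> and half of its zeros, which lack
  a neighbour of value two, are raised to one. If \<open>m = 4k + t\<close> with \<open>t \<noteq> 0\<close>, then \<open>t\<close> extra columns
  close the cycle: for \<open>t = 1\<close> a column of ones, with twos where the wrap-around to column \<open>0\<close> has been
  cut; for \<open>t = 2\<close> the columns \<open>2020 \<dots>\<close> and \<open>0101 \<dots>\<close>; for \<open>t = 3\<close> these two and a column
  of ones.\<close>

section \<open>Adjacency in the product in terms of natural-number indices\<close>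

lemma cong_succ_iff:
  assumes "j < m" "j' < m"
  shows "[int j' = int j + 1] (mod int m) \<longleftrightarrow> j' = Suc j mod m"
proof -
  have "[int j' = int j + 1] (mod int m) \<longleftrightarrow> [int j' = int (Suc j)] (mod int m)"
    by (simp add: add.commute)
  also have "\<dots> \<longleftrightarrow> [j' = Suc j] (mod m)"
    by (rule cong_int_iff)
  finally show ?thesis
    using assms by (simp add: cong_def)
qed

lemma cong_pred_iff:
  assumes "j < m" "j' < m"
  shows "[int j' = int j - 1] (mod int m) \<longleftrightarrow> j = Suc j' mod m"
proof -
  have "[int j' = int j - 1] (mod int m) \<longleftrightarrow> [int j = int j' + 1] (mod int m)"
    by (auto simp: cong_iff_dvd_diff algebra_simps dvd_diff_commute)
  then show ?thesis
    using cong_succ_iff[OF assms(2,1)] by simp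
qed

lemma path_cycle_adjacent_iff:
  assumes "i < n" "i' < n" "j < m" "j' < m"
  shows "((i, j), (i', j')) \<in> parcs (path_graph n \<box> cycle_graph m) \<longleftrightarrow>
    i = i' \<and> (j' = Suc j mod m \<or> j = Suc j' mod m) \<or> j = j' \<and> (i' = Suc i \<or> i = Suc i')"
  using assms by (auto simp: cartesian_path_cycle_adjacent cong_succ_iff cong_pred_iff)

lemma pverts_path_cycle:
  "pverts (path_graph n \<box> cycle_graph m) = {..<n} \<times> {..<m}"
  by (auto simp: cartesian_product_def path_graph_def cycle_graph_def)

text \<open>Adjacency is symmetric, so independence only has to be tested against the right and
  lower neighbours. In \<open>dom\<close> the left neighbour does not wrap around: zeros in column 0
  will be dominated vertically.\<close>

lemma OIRDF_path_cycleI: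
  assumes range: "\<And>i j. i < n \<Longrightarrow> j < m \<Longrightarrow> g i j \<in> {0, 1, 2}"
    and dom: "\<And>i j. i < n \<Longrightarrow> j < m \<Longrightarrow> g i j = 0 \<Longrightarrow>
      (\<exists>i'. i = Suc i' \<and> g i' j = 2) \<or> (Suc i < n \<and> g (Suc i) j = 2) \<or>
      (\<exists>j'. j = Suc j' \<and> g i j' = 2) \<or> g i (Suc j mod m) = 2"
    and right: "\<And>i j. i < n \<Longrightarrow> j < m \<Longrightarrow> g i j = 0 \<Longrightarrow> g i (Suc j mod m) \<noteq> 0"
    and down: "\<And>i j. Suc i < n \<Longrightarrow> j < m \<Longrightarrow> g i j = 0 \<Longrightarrow> g (Suc i) j \<noteq> 0"
  shows "OIRDF (path_graph n \<box> cycle_graph m) (\<lambda>(i, j). g i j)"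
proof -
  let ?G = "path_graph n \<box> cycle_graph m"
  have "\<exists>v\<in>pverts ?G. ((i, j), v) \<in> parcs ?G \<and> (\<lambda>(i, j). g i j) v = 2"
    if ij: "i < n" "j < m" "g i j = 0" for i j
  proof -
    obtain i' j' where "i' < n" "j' < m" "g i' j' = 2"
      "i = i' \<and> (j' = Suc j mod m \<or> j = Suc j' mod m) \<or> j = j' \<and> (i' = Suc i \<or> i = Suc i')"
    proof -
      consider i' where "i = Suc i'" "g i' j = 2" | "Suc i < n" "g (Suc i) j = 2"
        | j' where "j = Suc j'" "g i j' = 2" | "g i (Suc j mod m) = 2"
        using dom[OF ij] by blast
      then show thesis
      proof cases
        case 1
        then show thesis using ij that[of i' j] by simp
      next
        case 2
        then show thesis using ij that[of "Suc i" j] by simp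
      next
        case 3
        then show thesis using ij that[of i j'] by simp
      next
        case 4
        then show thesis using ij that[of i "Suc j mod m"] by simp
      qed
    qed
    then show ?thesis
      using ij by (intro bexI[of _ "(i', j')"]) (auto simp: path_cycle_adjacent_iff pverts_path_cycle)
  qed
  moreover have "((i, j), (i', j')) \<notin> parcs ?G"
    if "i < n" "j < m" "g i j = 0" "i' < n" "j' < m" "g i' j' = 0" for i j i' j'
    unfolding path_cycle_adjacent_iff[OF that(1,4,2,5)] using that right down by metis
  moreover have "(\<lambda>(i, j). g i j) ` pverts ?G \<subseteq> {0, 1, 2}"
    unfolding pverts_path_cycle using range by (intro image_subsetI) (simp add: mem_Times_iff case_prod_beta)
  ultimately show ?thesis
    by (auto simp: OIRDF_def independent_set_def pverts_path_cycle)
qed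

section \<open>The labelling and its validity\<close>

text \<open>The test \<open>(i + j) mod 4 = 2\<close> shifts the twos by two columns from one even
  row to the next. For \<open>t = 1\<close> the extra column repeats column 0 in the even
  rows.\<close>

definition oirdf_grid :: "nat \<Rightarrow> nat \<Rightarrow> nat \<Rightarrow> nat \<Rightarrow> nat \<Rightarrow> nat" where
  "oirdf_grid n k t i j =
    (if j < 4 * k then
       if even i then if odd j then 0 else if (i + j) mod 4 = 2 then 2 else 1
       else if odd j then 1 else if Suc i = n \<and> (i + j) mod 4 = 1 then 1 else 0
     else if t = 1 then if i mod 4 = 2 then 2 else 1
     else if j = 4 * k then if even i then 2 else 0
     else if j = 4 * k + 1 then if even i then 0 else 1
     else 1)"

text \<open>In the first \<open>4 * k\<close> columns, zeros in even rows get their two from the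
  left or right, zeros in odd rows from above or below.\<close>

lemma oirdf_grid_dominated:
  assumes "k > 0" "t < 4" "i < n" "j < 4 * k + t" "oirdf_grid n k t i j = 0"
  shows "(\<exists>i'. i = Suc i' \<and> oirdf_grid n k t i' j = 2) \<or>
    (Suc i < n \<and> oirdf_grid n k t (Suc i) j = 2) \<or>
    (\<exists>j'. j = Suc j' \<and> oirdf_grid n k t i j' = 2) \<or>
    oirdf_grid n k t i (Suc j mod (4 * k + t)) = 2"
proof -
  consider (even) "even i" "odd j" "j < 4 * k" | (odd) "odd i" "even j" "j < 4 * k"
    | (A) "odd i" "j = 4 * k" "t > 1" | (B) "even i" "j = Suc (4 * k)" "t > 1"
    using assms by (auto simp: oirdf_grid_def split: if_splits)
  then show ?thesis
  proof cases
    case even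
    then obtain j' where j': "j = Suc j'" "even j'" by (cases j) auto
    show ?thesis
    \<comment> \<open>The columns \<open>j - 1\<close> and \<open>j + 1\<close> differ by two, so
      exactly one of them passes the test modulo 4.\<close>
    proof (cases "(i + j') mod 4 = 2")
      case True
      then show ?thesis using even j' by (auto simp: oirdf_grid_def)
    next
      case False
      then have next2: "(i + Suc j) mod 4 = 2" using even j' by presburger
      show ?thesis
      proof (cases "Suc j < 4 * k")
        case True
        then show ?thesis using even next2 by (auto simp: oirdf_grid_def)
      next
        case False
        then have Sj: "Suc j = 4 * k" using even by simp
        then have "i mod 4 = 2" using next2 by simp
        \<comment> \<open>For \<open>t = 0\<close> the two is found in column 0 after wrapping
          around, otherwise in column \<open>4 * k\<close>.\<close>
        then show ?thesis using even Sj assms by (cases "t = 0") (auto simp: oirdf_grid_def)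
      qed
    qed
  next
    case odd
    then obtain i' where i': "i = Suc i'" "even i'" by (cases i) auto
    show ?thesis
    proof (cases "(i' + j) mod 4 = 2")
      case True
      then show ?thesis using odd i' by (auto simp: oirdf_grid_def)
    next
      case False
      then have "(Suc i + j) mod 4 = 2" "(i + j) mod 4 = 1" using odd i' by presburger+
      \<comment> \<open>In the last row such an entry would have been raised to one, so a row below
        exists.\<close>
      moreover from this have "Suc i < n" using assms odd by (auto simp: oirdf_grid_def split: if_splits)
      ultimately show ?thesis using odd by (auto simp: oirdf_grid_def)
    qed
  next
    case A
    then show ?thesis by (cases i) (auto simp: oirdf_grid_def)
  next
    case B
    then show ?thesis by (auto simp: oirdf_grid_def)
  qed
qed

text \<open>Every zero has \<open>i + j\<close> odd, which separates neighbours away from the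
  wrap-around. There, the last column has zeros in even rows only (none if \<open>t\<close> is odd),
  column 0 in odd rows only.\<close>

lemma oirdf_grid_right:
  assumes "k > 0" "t < 4" "j < 4 * k + t" "oirdf_grid n k t i j = 0"
  shows "oirdf_grid n k t i (Suc j mod (4 * k + t)) \<noteq> 0"
proof (cases "Suc j < 4 * k + t")
  case True
  moreover have "even i \<and> odd j \<or> odd i \<and> even j"
    using assms by (auto simp: oirdf_grid_def split: if_splits)
  moreover have "even i" if "Suc j = 4 * k"
    using that calculation(2) by (metis dvd_mult2 even_Suc even_numeral)
  ultimately show ?thesis
    using assms by (auto simp: oirdf_grid_def split: if_splits)
next
  case False
  then have Sj: "Suc j = 4 * k + t" using assms by simp
  have "even i"
  proof (rule ccontr)
    assume "odd i"
    then have "even j \<and> (j < 4 * k \<or> j = 4 * k \<and> t > 1)"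
      using assms by (auto simp: oirdf_grid_def split: if_splits)
    then show False using Sj by presburger
  qed
  then show ?thesis using Sj assms by (auto simp: oirdf_grid_def)
qed

lemma oirdf_grid_down:
  assumes "oirdf_grid n k t i j = 0"
  shows "oirdf_grid n k t (Suc i) j \<noteq> 0"
  using assms by (auto simp: oirdf_grid_def split: if_splits)

lemma OIRDF_oirdf_grid:
  assumes "k > 0" "t < 4"
  shows "OIRDF (path_graph n \<box> cycle_graph (4 * k + t)) (\<lambda>(i, j). oirdf_grid n k t i j)"
proof (rule OIRDF_path_cycleI)
  show "oirdf_grid n k t i j \<in> {0, 1, 2}" for i j
    by (simp add: oirdf_grid_def)
qed (fact oirdf_grid_dominated[OF assms], erule (1) oirdf_grid_right[OF assms],
    erule oirdf_grid_down)

section \<open>The weight of the labelling\<close>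

lemma sum_lessThan_four_blocks:
  fixes g :: "nat \<Rightarrow> nat"
  assumes "\<And>l. l < k \<Longrightarrow> g (4 * l) + g (4 * l + 1) + g (4 * l + 2) + g (4 * l + 3) = c"
  shows "(\<Sum>j<4 * k. g j) = c * k"
  using assms
proof (induction k)
  case (Suc k)
  have "4 * Suc k = Suc (Suc (Suc (Suc (4 * k))))" by simp
  then have "(\<Sum>j<4 * Suc k. g j) =
      (\<Sum>j<4 * k. g j) + (g (4 * k) + g (4 * k + 1) + g (4 * k + 2) + g (4 * k + 3))"
    by (simp add: numeral_eq_Suc)
  then show ?case using Suc by simp
qed simp

text \<open>Contribution of the \<open>t\<close> extra columns to row \<open>i\<close>. For
  \<open>t = 2\<close> it is 2 + 0 in even and 0 + 1 in odd rows; \<open>t = 3\<close> adds a one to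
  each.\<close>

definition tail_weight :: "nat \<Rightarrow> nat \<Rightarrow> nat" where
  "tail_weight t i =
    (if t = 0 then 0 else if t = 1 then if i mod 4 = 2 then 2 else 1
     else if even i then t else t - 1)"

lemma oirdf_grid_row:
  assumes "t < 4"
  shows "(\<Sum>j<4 * k + t. oirdf_grid n k t i j) =
    (if even i then 3 * k else 2 * k) + (if odd i \<and> Suc i = n then k else 0) + tail_weight t i"
proof -
  \<comment> \<open>Four consecutive columns hold 1 + 2 in an even row and 1 + 1 in an odd one; an
    odd last row has one raised zero more.\<close>
  let ?c = "if even i \<or> Suc i = n then 3 else 2 :: nat"
  have "(\<Sum>j<4 * k. oirdf_grid n k t i j) = ?c * k"
  proof (rule sum_lessThan_four_blocks)
    fix l assume "l < k"
    have mods: "(i + 4 * l) mod 4 = i mod 4" "(i + (4 * l + 2)) mod 4 = (i + 2) mod 4"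
      by presburger+
    consider "i mod 4 = 0" | "i mod 4 = 1" | "i mod 4 = 2" | "i mod 4 = 3" by linarith
    then show "oirdf_grid n k t i (4 * l) + oirdf_grid n k t i (4 * l + 1) +
      oirdf_grid n k t i (4 * l + 2) + oirdf_grid n k t i (4 * l + 3) = ?c"
    proof cases
      case 1
      then have "even i" "(i + 2) mod 4 = 2" by presburger+
      then show ?thesis using 1 mods \<open>l < k\<close> by (simp add: oirdf_grid_def)
    next
      case 2
      then have "odd i" "(i + 2) mod 4 = 3" by presburger+
      then show ?thesis using 2 mods \<open>l < k\<close> by (simp add: oirdf_grid_def)
    next
      case 3
      then have "even i" "(i + 2) mod 4 = 0" by presburger+
      then show ?thesis using 3 mods \<open>l < k\<close> by (simp add: oirdf_grid_def)
    next
      case 4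
      then have "odd i" "(i + 2) mod 4 = 1" by presburger+
      then show ?thesis using 4 mods \<open>l < k\<close> by (simp add: oirdf_grid_def)
    qed
  qed
  moreover have "(\<Sum>j<4 * k + t. oirdf_grid n k t i j) =
      (\<Sum>j<4 * k. oirdf_grid n k t i j) + tail_weight t i"
  proof -
    consider "t = 0" | "t = 1" | "t = 2" | "t = 3" using assms by linarith
    then show ?thesis
    proof cases
      case 3
      then have "(\<Sum>j<4 * k + t. oirdf_grid n k t i j) = (\<Sum>j<4 * k. oirdf_grid n k t i j) +
          oirdf_grid n k t i (4 * k) + oirdf_grid n k t i (4 * k + 1)"
        by (simp add: numeral_2_eq_2)
      then show ?thesis using 3 by (simp add: oirdf_grid_def tail_weight_def)
    next
      case 4
      then have "(\<Sum>j<4 * k + t. oirdf_grid n k t i j) = (\<Sum>j<4 * k. oirdf_grid n k t i j) +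
          oirdf_grid n k t i (4 * k) + oirdf_grid n k t i (4 * k + 1) +
          oirdf_grid n k t i (4 * k + 2)"
        by (simp add: numeral_2_eq_2 numeral_3_eq_3)
      then show ?thesis using 4 by (simp add: oirdf_grid_def tail_weight_def)
    qed (simp_all add: oirdf_grid_def tail_weight_def)
  qed
  ultimately show ?thesis by auto
qed

lemma sum_parity:
  fixes a b :: nat
  shows "(\<Sum>i<n. if even i then a else b) = (n + 1) div 2 * a + n div 2 * b"
proof (induction n)
  case (Suc n)
  then show ?case by (cases "even n") (simp_all add: algebra_simps)
qed simp

lemma sum_tail_weight:
  "(\<Sum>i<n. tail_weight t i) =
    (if t = 0 then 0 else if t = 1 then n + (n + 1) div 4
     else (n + 1) div 2 * t + n div 2 * (t - 1))"
proof (cases "t = 1")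
  case True
  have "(\<Sum>i<n. if i mod 4 = 2 then 2 else 1 :: nat) = n + (n + 1) div 4"
  proof (induction n)
    case (Suc n)
    \<comment> \<open>\<open>(n + 1) div 4\<close> counts the rows \<open>i < n\<close> with
      \<open>i mod 4 = 2\<close>.\<close>
    have "(Suc n + 1) div 4 = (n + 1) div 4 + (if n mod 4 = 2 then 1 else 0)" by presburger
    then show ?case using Suc by simp
  qed simp
  then show ?thesis using True by (simp add: tail_weight_def)
next
  case False
  then show ?thesis by (simp add: tail_weight_def sum_parity)
qed

lemma weight_oirdf_grid:
  assumes "t < 4" "n > 0"
  shows "weight (path_graph n \<box> cycle_graph (4 * k + t)) (\<lambda>(i, j). oirdf_grid n k t i j) =
    (n + 1) div 2 * (3 * k) + n div 2 * (2 * k) + (if even n then k else 0) +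
    (\<Sum>i<n. tail_weight t i)"
proof -
  have last: "(\<Sum>i<n. if odd i \<and> Suc i = n then k else 0) = (if even n then k else 0)"
  proof -
    have "(\<Sum>i<n. if odd i \<and> Suc i = n then k else 0) =
        (\<Sum>i<n. if i = n - 1 then if even n then k else 0 else 0)"
      using assms by (intro sum.cong) auto
    then show ?thesis using assms by simp
  qed
  have "weight (path_graph n \<box> cycle_graph (4 * k + t)) (\<lambda>(i, j). oirdf_grid n k t i j) =
      (\<Sum>i<n. \<Sum>j<4 * k + t. oirdf_grid n k t i j)"
    by (simp add: weight_def pverts_path_cycle sum.cartesian_product)
  also have "\<dots> = (\<Sum>i<n. (if even i then 3 * k else 2 * k) +
      (if odd i \<and> Suc i = n then k else 0) + tail_weight t i)"
    using assms by (simp only: oirdf_grid_row)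
  finally show ?thesis
    by (simp only: sum.distrib sum_parity last)
qed

lemma weight_oirdf_grid_le:
  assumes "t < 4" "n > 0" "m = 4 * k + t"
  shows "8 * weight (path_graph n \<box> cycle_graph m) (\<lambda>(i, j). oirdf_grid n k t i j)
    \<le> 5 * m * n + 5 * n + 2 * m"
proof -
  \<comment> \<open>Writing \<open>n\<close> through \<open>q\<close> removes the halves, leaving a
    linear inequality in \<open>k * q\<close>, \<open>k\<close> and \<open>q\<close>. For
    \<open>t = 1\<close>, \<open>quarter\<close> bounds eight times the tail by
    \<open>10 * n + 2\<close>, exactly its share of the right-hand side.\<close>
  define q where "q = n div 2"
  have *: "n = 2 * q \<or> n = 2 * q + 1" unfolding q_def by presburger
  have quarter: "4 * ((n + 1) div 4) \<le> n + 1" by simp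
  consider "t = 0" | "t = 1" | "t = 2" | "t = 3" using assms by linarith
  then show ?thesis
    using * quarter assms(2) unfolding assms(3) weight_oirdf_grid[OF assms(1,2)] sum_tail_weight
    by cases (auto simp: algebra_simps)
qed

theorem theorem5:
  fixes m n :: nat
  assumes "m \<ge> 4" and "n \<ge> 4"
  shows "real (gamma_oiR (path_graph n \<box> cycle_graph m))
    \<le> (5 * real m * real n + 5 * real n + 2 * real m) / 8"
proof -
  define k t where "k = m div 4" and "t = m mod 4"
  have m: "m = 4 * k + t" "k > 0" "t < 4"
    using assms by (auto simp: k_def t_def)
  have "gamma_oiR (path_graph n \<box> cycle_graph m)
      \<le> weight (path_graph n \<box> cycle_graph m) (\<lambda>(i, j). oirdf_grid n k t i j)"
    unfolding m(1) by (rule gamma_oiR_le[OF OIRDF_oirdf_grid[OF m(2,3)]])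
  moreover have "8 * weight (path_graph n \<box> cycle_graph m) (\<lambda>(i, j). oirdf_grid n k t i j)
      \<le> 5 * m * n + 5 * n + 2 * m"
    using assms m by (intro weight_oirdf_grid_le) auto
  ultimately have "8 * gamma_oiR (path_graph n \<box> cycle_graph m) \<le> 5 * m * n + 5 * n + 2 * m"
    by linarith
  then have "real (8 * gamma_oiR (path_graph n \<box> cycle_graph m)) \<le> real (5 * m * n + 5 * n + 2 * m)"
    by (rule of_nat_mono)
  then show ?thesis by simp
qed

end
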